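(* Let $G$ be a connected simply-connected simple complex Lie group with Lie algebra $\mathfrak g$, and fix a compact real form $\mathfrak k\subset\mathfrak g$. Let $\mathcal{O}\subset\mathfrak g$ be a nonzero nilpotent adjoint orbit. Then $\mathcal{O}$ is a Moore–Penrose orbit if and only if $\mathrm{ht}(\mathcal{O})=2$. In this case, for every $e\in\mathcal{O}$ there is a unique $\mathfrak{sl}_2$-triple $\langle e,h,f\rangle$ with $h\in i\mathfrak k$.
   Context: An $\mathfrak{sl}_2$-triple is $(e,h,f)$ with $[e,f]=h$, $[h,e]=2e$, $[h,f]=-2f$. A nilpotent orbit $\mathcal{O}$ is a Moore–Penrose orbit if for every $e\in\mathcal{O}$ there exists an $\mathfrak{sl}_2$-triple $\langle e,h,f\rangle$ with $h\in i\mathfrak k$. The height $\mathrm{ht}(\mathcal{O})$ of $\mathcal{O}=\mathrm{Ad}(G)e$ is the largest integer $k$ with $\mathrm{ad}(e)^k\neq0$. *)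

theory Defs
  imports "HOL-Analysis.Analysis"
begin

definition lie_algebra :: "(complex^'n \<Rightarrow> complex^'n \<Rightarrow> complex^'n) \<Rightarrow> bool" where
  "lie_algebra br \<longleftrightarrow>
     (\<forall>a b x y z. br (a *s x + b *s y) z = a *s br x z + b *s br y z) \<and>
     (\<forall>a b x y z. br z (a *s x + b *s y) = a *s br z x + b *s br z y) \<and>
     (\<forall>x. br x x = 0) \<and>
     (\<forall>x y z. br x (br y z) + br y (br z x) + br z (br x y) = 0)"

definition complex_subspace :: "(complex^'n) set \<Rightarrow> bool" where
  "complex_subspace I \<longleftrightarrow> 0 \<in> I \<and> (\<forall>x\<in>I. \<forall>y\<in>I. x + y \<in> I) \<and> (\<forall>c. \<forall>x\<in>I. c *s x \<in> I)"

definition lie_ideal :: "(complex^'n \<Rightarrow> complex^'n \<Rightarrow> complex^'n) \<Rightarrow> (complex^'n) set \<Rightarrow> bool" where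
  "lie_ideal br I \<longleftrightarrow> complex_subspace I \<and> (\<forall>x y. y \<in> I \<longrightarrow> br x y \<in> I)"

definition simple_lie_algebra :: "(complex^'n \<Rightarrow> complex^'n \<Rightarrow> complex^'n) \<Rightarrow> bool" where
  "simple_lie_algebra br \<longleftrightarrow> lie_algebra br \<and> (\<exists>x y. br x y \<noteq> 0) \<and>
     (\<forall>I. lie_ideal br I \<longrightarrow> I = {0} \<or> I = UNIV)"

definition ad_mat :: "(complex^'n \<Rightarrow> complex^'n \<Rightarrow> complex^'n) \<Rightarrow> complex^'n \<Rightarrow> complex^'n^'n" where
  "ad_mat br x = (\<chi> i j. br x (axis j 1) $ i)"

fun mat_pow :: "complex^'n^'n \<Rightarrow> nat \<Rightarrow> complex^'n^'n" where
  "mat_pow A 0 = mat 1"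
| "mat_pow A (Suc k) = A ** mat_pow A k"

definition mat_exp :: "complex^'n^'n \<Rightarrow> complex^'n^'n" where
  "mat_exp A = (\<Sum>k. (1 / fact k) *\<^sub>R mat_pow A k)"

definition killing :: "(complex^'n \<Rightarrow> complex^'n \<Rightarrow> complex^'n) \<Rightarrow> complex^'n \<Rightarrow> complex^'n \<Rightarrow> complex" where
  "killing br x y = (\<Sum>i\<in>UNIV. br x (br y (axis i 1)) $ i)"

definition real_subspace :: "(complex^'n) set \<Rightarrow> bool" where
  "real_subspace K \<longleftrightarrow> 0 \<in> K \<and> (\<forall>x\<in>K. \<forall>y\<in>K. x + y \<in> K) \<and> (\<forall>r::real. \<forall>x\<in>K. complex_of_real r *s x \<in> K)"

definition times_i :: "(complex^'n) set \<Rightarrow> (complex^'n) set" where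
  "times_i K = (\<lambda>x. \<i> *s x) ` K"

definition compact_real_form :: "(complex^'n \<Rightarrow> complex^'n \<Rightarrow> complex^'n) \<Rightarrow> (complex^'n) set \<Rightarrow> bool" where
  "compact_real_form br K \<longleftrightarrow> real_subspace K \<and> (\<forall>x\<in>K. \<forall>y\<in>K. br x y \<in> K) \<and>
     K \<inter> times_i K = {0} \<and> (\<forall>z. \<exists>x\<in>K. \<exists>y\<in>K. z = x + \<i> *s y) \<and>
     (\<forall>x\<in>K. x \<noteq> 0 \<longrightarrow> killing br x x \<in> \<real> \<and> Re (killing br x x) < 0)"

text \<open>Ad(G) for the connected simply connected group G with Lie algebra g equals the
  inner automorphism group Int(g), generated by the exp(ad x).\<close>
inductive_set inner_auts :: "(complex^'n \<Rightarrow> complex^'n \<Rightarrow> complex^'n) \<Rightarrow> (complex^'n^'n) set"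
  for br where
  id: "mat 1 \<in> inner_auts br"
| step: "A \<in> inner_auts br \<Longrightarrow> mat_exp (ad_mat br x) ** A \<in> inner_auts br"

definition adjoint_orbit :: "(complex^'n \<Rightarrow> complex^'n \<Rightarrow> complex^'n) \<Rightarrow> complex^'n \<Rightarrow> (complex^'n) set" where
  "adjoint_orbit br e = {A *v e | A. A \<in> inner_auts br}"

definition nilpotent_elem :: "(complex^'n \<Rightarrow> complex^'n \<Rightarrow> complex^'n) \<Rightarrow> complex^'n \<Rightarrow> bool" where
  "nilpotent_elem br e \<longleftrightarrow> (\<exists>k. mat_pow (ad_mat br e) k = 0)"

definition height :: "(complex^'n \<Rightarrow> complex^'n \<Rightarrow> complex^'n) \<Rightarrow> complex^'n \<Rightarrow> nat" where
  "height br e = (GREATEST k. mat_pow (ad_mat br e) k \<noteq> 0)"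

definition sl2_triple :: "(complex^'n \<Rightarrow> complex^'n \<Rightarrow> complex^'n) \<Rightarrow> complex^'n \<Rightarrow> complex^'n \<Rightarrow> complex^'n \<Rightarrow> bool" where
  "sl2_triple br e h f \<longleftrightarrow> br e f = h \<and> br h e = 2 *s e \<and> br h f = (-2) *s f"

definition moore_penrose_orbit :: "(complex^'n \<Rightarrow> complex^'n \<Rightarrow> complex^'n) \<Rightarrow> (complex^'n) set \<Rightarrow> (complex^'n) set \<Rightarrow> bool" where
  "moore_penrose_orbit br K Orb \<longleftrightarrow> (\<forall>e\<in>Orb. \<exists>h f. sl2_triple br e h f \<and> h \<in> times_i K)"

end

theory Submission
  imports Defs
begin

text \<open>Write \<open>E = ad e\<close>, let \<open>cj\<close> be the conjugation with respect to \<open>K\<close>, so that \<open>h \<in> i K\<close> means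
\<open>cj h = - h\<close> and \<open>- killing x (cj y)\<close> is a Hermitian inner product. The subspace
\<open>N = ker E \<inter> im E\<close> is isotropic for the Killing form and any two neutral elements of \<open>e\<close> differ by
an element of \<open>N\<close>; as a nonzero element of \<open>i K\<close> is not isotropic, there is at most one triple.

If \<open>E\<^sup>3 = 0\<close>, then conversely every element of \<open>h + N\<close> is neutral. The one orthogonal to \<open>N\<close> has its
conjugate in \<open>N\<^sup>\<bottom> = ker E + im E\<close>, which \<open>ad h\<close> maps into \<open>N\<close>. So \<open>[h, cj h]\<close> is an
isotropic element of \<open>i K\<close>, hence zero: \<open>ad h\<close> is normal with real eigenvalues, and \<open>cj h = - h\<close>.

If \<open>E\<^sup>m \<noteq> 0 = E\<^sup>m\<^sup>+\<^sup>1\<close> with \<open>m \<ge> 3\<close>, take a triple with \<open>h \<in> i K\<close>, a vector \<open>x \<noteq> 0\<close> of the top weight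
\<open>m\<close> and \<open>y = [f, x]\<close>. Then \<open>exp (ad y)\<close> moves \<open>e\<close> to \<open>e - m x\<close> and \<open>h\<close> to \<open>h - (m - 2) y\<close>, and isotropy
forces any neutral element of \<open>e - m x\<close> in \<open>i K\<close> to be \<open>h\<close> itself; but \<open>e - m x\<close> is not of weight 2.\<close>

section \<open>Matrices\<close>

text \<open>With projections \<open>P\<^sub>j\<close> onto \<open>im M\<^sup>j\<close>, one has \<open>tr (M P\<^sub>j) = tr (P\<^sub>j\<^sub>+\<^sub>1 M P\<^sub>j) = tr (M P\<^sub>j\<^sub>+\<^sub>1)\<close>.\<close>
lemma trace_nilpotent:
  fixes M :: "complex^'n^'n"
  assumes nil: "\<And>v. ((*v) M ^^ k) v = 0"
  shows "trace M = 0"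
proof -
  have "\<exists>P. (\<forall>w. P *v w \<in> range ((*v) M ^^ j)) \<and> (\<forall>w\<in>range ((*v) M ^^ j). P *v w = w)
      \<and> trace (M ** P) = trace M" for j
  proof (induction j)
    case 0
    show ?case by (rule exI[of _ "mat 1"]) simp
  next
    case (Suc j)
    then obtain P where P: "\<And>w. P *v w \<in> range ((*v) M ^^ j)"
      "\<And>w. w \<in> range ((*v) M ^^ j) \<Longrightarrow> P *v w = w" "trace (M ** P) = trace M"
      by blast
    let ?R = "range ((*v) M ^^ Suc j)"
    have "Vector_Spaces.linear (*s) (*s) ((*v) M ^^ i)" for i
    proof (induction i)
      case 0
      show ?case using vec.linear_id by (simp add: id_def)
    next
      case (Suc i)
      then show ?case
        using Vector_Spaces.linear_compose[OF Suc matrix_vector_mul_linear_gen] by (simp add: o_def)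
    qed
    then have "vec.subspace ?R"
      by (rule vec.linear_subspace_image) (rule vec.subspace_UNIV)
    from vec.linear_exists_left_inverse_on[OF vec.linear_id this]
    obtain g :: "complex^'n \<Rightarrow> complex^'n" where g: "range g \<subseteq> ?R" "Vector_Spaces.linear (*s) (*s) g" "\<And>v. v \<in> ?R \<Longrightarrow> g v = v"
      by auto
    define Q where "Q = matrix g"
    have Q: "Q *v w = g w" for w
      unfolding Q_def using g(2) by (simp add: matrix_works)
    have sub: "?R \<subseteq> range ((*v) M ^^ j)"
      by (auto simp: funpow_swap1)
    have 1: "Q ** (M ** P) = M ** P"
    proof -
      have "M *v (P *v w) \<in> ?R" for w
        using P(1)[of w] by auto
      then show ?thesis
        using g(3) by (simp add: matrix_eq Q flip: matrix_vector_mul_assoc)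
    qed
    have 2: "P ** Q = Q"
    proof -
      have "P *v g x = g x" for x
        using P(2) g(1) sub by blast
      then show ?thesis
        by (simp add: matrix_eq Q flip: matrix_vector_mul_assoc)
    qed
    have "trace (M ** Q) = trace (M ** P ** Q)"
      by (simp add: 2 flip: matrix_mul_assoc)
    also have "\<dots> = trace M"
      by (simp add: trace_mul_sym[of "M ** P"] 1 P)
    finally show ?case
      using g Q by (intro exI[of _ Q]) auto
  qed
  from this[of k] obtain P where P: "\<And>w. P *v w = 0" "trace (M ** P) = trace M"
    using nil by auto
  have "M ** P = mat 0"
    using P(1) by (simp add: matrix_eq flip: matrix_vector_mul_assoc)
  then show ?thesis
    using P(2) by (metis trace_0)
qed

lemma nilpotent_product:
  fixes A Z :: "complex^'n \<Rightarrow> complex^'n"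
  assumes lin: "Vector_Spaces.linear (*s) (*s) A" "Vector_Spaces.linear (*s) (*s) Z"
    and cube: "\<And>w. A (A (A w)) = 0"
    and comm: "\<And>w. A (A (Z w)) + Z (A (A w)) = 2 *s A (Z (A w))"
  shows "A (Z (A (Z (A (Z (A (Z (A w)))))))) = 0"
proof -
  interpret A: Vector_Spaces.linear "(*s)" "(*s)" A by fact
  interpret Z: Vector_Spaces.linear "(*s)" "(*s)" Z by fact
  have r: "A (Z (A w)) = (1/2) *s (A (A (Z w)) + Z (A (A w)))" for w
    by (simp add: comm)
  have AZAA: "A (Z (A (A w))) = 0" and AAZA: "A (A (Z (A w))) = 0" for w
  proof -
    have p: "2 *s A (Z (A (A w))) = A (A (Z (A w)))"
      by (simp add: cube flip: comm)
    have q: "2 *s A (A (Z (A w))) = A (Z (A (A w)))"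
      using arg_cong[OF comm[of w], of A] by (simp only: A.add A.scale cube add_0_left)
    have "A (Z (A (A w))) $ i = 0 \<and> A (A (Z (A w))) $ i = 0" for i
      using arg_cong[OF p, of "\<lambda>v. v $ i"] arg_cong[OF q, of "\<lambda>v. v $ i"]
      by (simp add: complex_eq_iff)
    then show "A (Z (A (A w))) = 0" "A (A (Z (A w))) = 0"
      by (simp_all add: vec_eq_iff)
  qed
  have 1: "A (Z (A (Z (A w)))) = (1/2) *s A (A (Z (Z (A w))))" for w
    using r[of "Z (A w)"] by (simp add: AAZA)
  have 2: "A (Z (A (Z (A w)))) = (1/2) *s A (Z (Z (A (A w))))" for w
    by (subst r[of w]) (simp add: A.add Z.add A.scale Z.scale AZAA del: vector_add_ldistrib vec.scale_right_distrib)
  have 3: "A (A (Z (Z (A w)))) = A (Z (Z (A (A w))))" for w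
    using 1[of w] 2[of w] by (simp add: vec_eq_iff)
  have "A (Z (A (Z (A (Z (A (Z (A w)))))))) = (1/2) *s A (A (Z (Z (A (Z (A (Z (A w))))))))"
    by (rule 1)
  also have "\<dots> = (1/4) *s A (A (Z (Z (A (Z (Z (A (A w))))))))"
    by (subst 2[of w]) (simp add: A.scale Z.scale)
  also have "\<dots> = (1/4) *s A (Z (Z (A (A (Z (Z (A (A w))))))))"
    by (simp only: 3)
  also have "A (A (Z (Z (A (A w))))) = 0"
    by (simp add: 3 cube A.zero Z.zero)
  finally show ?thesis
    by (simp add: A.zero Z.zero)
qed

lemma bilinear_Cauchy_product_sums:
  fixes h :: "'a::euclidean_space \<Rightarrow> 'b::euclidean_space \<Rightarrow> 'c::euclidean_space"
  assumes h: "bilinear h"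
    and a: "summable (\<lambda>n. norm (a n))" and b: "summable (\<lambda>n. norm (b n))"
  shows "(\<lambda>n. \<Sum>i\<le>n. h (a i) (b (n - i))) sums h (\<Sum>n. a n) (\<Sum>n. b n)"
proof -
  have expand: "h x y = (\<Sum>u\<in>Basis. \<Sum>v\<in>Basis. ((x \<bullet> u) * (y \<bullet> v)) *\<^sub>R h u v)" for x y
  proof -
    have "h x y = h (\<Sum>u\<in>Basis. (x \<bullet> u) *\<^sub>R u) (\<Sum>v\<in>Basis. (y \<bullet> v) *\<^sub>R v)"
      by (simp add: euclidean_representation)
    also have "\<dots> = (\<Sum>(u,v)\<in>Basis \<times> Basis. h ((x \<bullet> u) *\<^sub>R u) ((y \<bullet> v) *\<^sub>R v))"
      by (rule bilinear_sum[OF h])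
    also have "\<dots> = (\<Sum>u\<in>Basis. \<Sum>v\<in>Basis. ((x \<bullet> u) * (y \<bullet> v)) *\<^sub>R h u v)"
      by (simp add: sum.cartesian_product bilinear_lmul[OF h] bilinear_rmul[OF h] mult.commute)
    finally show ?thesis .
  qed
  have coord: "summable (\<lambda>n. norm (c n \<bullet> u))" if "summable (\<lambda>n. norm (c n))" "u \<in> Basis"
    for c :: "nat \<Rightarrow> 'd::euclidean_space" and u
    by (rule summable_comparison_test'[OF that(1)]) (simp add: that(2) Basis_le_norm)
  have inn: "(\<Sum>n. c n) \<bullet> u = (\<Sum>n. c n \<bullet> u)" if "summable (\<lambda>n. norm (c n))"
    for c :: "nat \<Rightarrow> 'd::euclidean_space" and u
    using bounded_linear.suminf[OF bounded_linear_inner_left summable_norm_cancel[OF that]] by simp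
  have "(\<lambda>n. (\<Sum>i\<le>n. (a i \<bullet> u) * (b (n - i) \<bullet> v)) *\<^sub>R h u v) sums
      ((((\<Sum>n. a n) \<bullet> u) * ((\<Sum>n. b n) \<bullet> v)) *\<^sub>R h u v)" if "u \<in> Basis" "v \<in> Basis" for u v
    unfolding inn[OF a] inn[OF b]
    by (intro sums_scaleR_left Cauchy_product_sums coord a b that)
  then have "(\<lambda>n. \<Sum>u\<in>Basis. \<Sum>v\<in>Basis. (\<Sum>i\<le>n. (a i \<bullet> u) * (b (n - i) \<bullet> v)) *\<^sub>R h u v) sums
      (\<Sum>u\<in>Basis. \<Sum>v\<in>Basis. (((\<Sum>n. a n) \<bullet> u) * ((\<Sum>n. b n) \<bullet> v)) *\<^sub>R h u v)"
    by (intro sums_sum) auto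
  moreover have "(\<Sum>u\<in>Basis. \<Sum>v\<in>Basis. (\<Sum>i\<le>n. (a i \<bullet> u) * (b (n - i) \<bullet> v)) *\<^sub>R h u v)
      = (\<Sum>i\<le>n. h (a i) (b (n - i)))" for n
    unfolding expand[of "a _"] scaleR_left.sum
    by (subst sum.swap[of _ "{..n}"], subst sum.swap[of _ "{..n}"]) simp
  ultimately show ?thesis
    by (simp add: expand[symmetric])
qed

lemma mat_pow_vector: "mat_pow A k *v v = ((*v) A ^^ k) v"
  by (induction k) (simp_all flip: matrix_vector_mul_assoc)

lemma mat_exp_summable:
  fixes A :: "complex^'n^'n"
  shows "summable (\<lambda>k. norm ((1 / fact k) *\<^sub>R mat_pow A k))"
proof -
  have "linear (\<lambda>X. A ** X :: complex^'n^'n)"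
    by (rule linearI) (simp_all add: matrix_matrix_mult_def vec_eq_iff scaleR_right.sum distrib_left sum.distrib)
  then obtain c where c: "c > 0" "\<And>X. norm (A ** X :: complex^'n^'n) \<le> norm X * c"
    using bounded_linear.pos_bounded linear_conv_bounded_linear by blast
  have le: "norm (mat_pow A k) \<le> norm (mat 1 :: complex^'n^'n) * c ^ k" for k
  proof (induction k)
    case (Suc k)
    have "norm (mat_pow A (Suc k)) \<le> norm (mat_pow A k) * c"
      using c(2) by simp
    also have "\<dots> \<le> norm (mat 1 :: complex^'n^'n) * c ^ k * c"
      using Suc c(1) by (intro mult_right_mono) auto
    finally show ?case by (simp add: mult_ac)
  qed simp
  have "summable (\<lambda>k. norm (mat 1 :: complex^'n^'n) * (inverse (fact k) * c ^ k))"
    by (intro summable_mult summable_exp)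
  then show ?thesis
    by (rule summable_comparison_test'[where N=0])
       (use le in \<open>auto simp: divide_simps\<close>)
qed

lemma bilinear_mat_vec: "bilinear (\<lambda>(A :: complex^'n^'n) v. A *v v)"
  unfolding bilinear_def
  by (auto intro!: linearI simp: algebra_simps matrix_vector_mult_def vec_eq_iff scaleR_right.sum sum.distrib)

lemma mat_exp_vector_summable:
  fixes A :: "complex^'n^'n"
  shows "summable (\<lambda>k. norm ((1 / fact k) *\<^sub>R (mat_pow A k *v v)))"
proof -
  have "bounded_bilinear (\<lambda>(A :: complex^'n^'n) v. A *v v)"
    using bilinear_mat_vec bilinear_conv_bounded_bilinear by blast
  then have bl: "bounded_linear (\<lambda>A :: complex^'n^'n. A *v v)"
    by (rule bounded_bilinear.bounded_linear_left)
  then obtain c where c: "\<And>A :: complex^'n^'n. norm (A *v v) \<le> norm A * c"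
    using bounded_linear.bounded by blast
  have "summable (\<lambda>k. norm ((1 / fact k) *\<^sub>R mat_pow A k) * c)"
    by (intro summable_mult2 mat_exp_summable)
  then show ?thesis
    by (rule summable_comparison_test'[where N=0])
       (use c in \<open>auto simp: divide_simps\<close>)
qed

lemma mat_exp_vector:
  fixes A :: "complex^'n^'n"
  shows "mat_exp A *v v = (\<Sum>k. (1 / fact k) *\<^sub>R (mat_pow A k *v v))"
proof -
  have "bounded_bilinear (\<lambda>(A :: complex^'n^'n) v. A *v v)"
    using bilinear_mat_vec bilinear_conv_bounded_bilinear by blast
  then have bl: "bounded_linear (\<lambda>A :: complex^'n^'n. A *v v)"
    by (rule bounded_bilinear.bounded_linear_left)
  show ?thesis
    unfolding mat_exp_def bounded_linear.suminf[OF bl summable_norm_cancel[OF mat_exp_summable]]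
    by (simp add: bilinear_lmul[OF bilinear_mat_vec])
qed

lemma mat_exp_uminus:
  fixes A :: "complex^'n^'n"
  shows "mat_exp A *v (mat_exp (- A) *v v) = v"
proof -
  have pm: "mat_pow (- A) k *v v = (-1)^k *\<^sub>R (mat_pow A k *v v)" for k
  proof (induction k)
    case (Suc k)
    have "mat_pow (- A) (Suc k) *v v = - (A *v (mat_pow (- A) k *v v))"
      using matrix_vector_mult_diff_rdistrib[of 0 A] by (simp flip: matrix_vector_mul_assoc)
    then show ?case
      by (simp add: Suc bilinear_rmul[OF bilinear_mat_vec] matrix_vector_mul_assoc)
  qed simp
  have pa: "mat_pow A i *v (mat_pow A j *v v) = mat_pow A (i + j) *v v" for i j
    by (simp add: mat_pow_vector funpow_add)
  have "(\<lambda>n. \<Sum>i\<le>n. ((1 / fact i) *\<^sub>R mat_pow A i) *v ((1 / fact (n - i)) *\<^sub>R (mat_pow (- A) (n - i) *v v)))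
     sums (mat_exp A *v (mat_exp (- A) *v v))"
    unfolding mat_exp_vector[of "- A"] mat_exp_def[of A]
    by (rule bilinear_Cauchy_product_sums[OF bilinear_mat_vec mat_exp_summable mat_exp_vector_summable])
  moreover have "(\<Sum>i\<le>n. ((1 / fact i) *\<^sub>R mat_pow A i) *v ((1 / fact (n - i)) *\<^sub>R (mat_pow (- A) (n - i) *v v)))
     = (if n = 0 then v else 0)" for n
  proof -
    have "(\<Sum>i\<le>n. ((1 / fact i) *\<^sub>R mat_pow A i) *v ((1 / fact (n - i)) *\<^sub>R (mat_pow (- A) (n - i) *v v)))
      = (\<Sum>i\<le>n. ((-1)^n * (1 / fact n) * ((-1)^i * real (n choose i))) *\<^sub>R (mat_pow A n *v v))"
    proof (rule sum.cong[OF refl])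
      fix i assume "i \<in> {..n}"
      then have i: "i \<le> n" by simp
      have s: "(-1::real)^(n - i) = (-1)^n * (-1)^i"
        using i by (simp add: minus_one_power_iff)
      show "((1 / fact i) *\<^sub>R mat_pow A i) *v ((1 / fact (n - i)) *\<^sub>R (mat_pow (- A) (n - i) *v v))
        = ((-1)^n * (1 / fact n) * ((-1)^i * real (n choose i))) *\<^sub>R (mat_pow A n *v v)"
        using i by (simp add: pm bilinear_rmul[OF bilinear_mat_vec] bilinear_lmul[OF bilinear_mat_vec] pa s
            binomial_fact field_simps)
    qed
    also have "\<dots> = ((-1)^n * (1 / fact n) * (\<Sum>i\<le>n. (-1)^i * real (n choose i))) *\<^sub>R (mat_pow A n *v v)"
      by (simp only: scaleR_left.sum[symmetric] sum_distrib_left)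
    also have "\<dots> = (if n = 0 then v else 0)"
      using choose_alternating_sum[of n, where 'a=real] by auto
    finally show ?thesis .
  qed
  ultimately have "(\<lambda>n. if n = 0 then v else 0) sums (mat_exp A *v (mat_exp (- A) *v v))"
    by simp
  moreover have "(\<lambda>n. if n = 0 then v else 0) sums v"
    using sums_single[of 0 "\<lambda>_. v"] by simp
  ultimately show ?thesis
    using sums_unique2 by blast
qed

section \<open>Lie algebras and neutral elements\<close>

locale lie =
  fixes br :: "complex^'n \<Rightarrow> complex^'n \<Rightarrow> complex^'n"
  assumes lie_algebra: "lie_algebra br"
begin

lemma br_comb_left: "br (a *s x + b *s y) z = a *s br x z + b *s br y z"
  and br_comb_right: "br z (a *s x + b *s y) = a *s br z x + b *s br z y"
  and br_self [simp]: "br x x = 0"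
  and br_cyclic: "br x (br y z) + br y (br z x) + br z (br x y) = 0"
  using lie_algebra unfolding lie_algebra_def by auto

lemma linear_br: "Vector_Spaces.linear (*s) (*s) (br x)"
proof unfold_locales
  fix y z and c :: complex
  show "br x (y + z) = br x y + br x z" "br x (c *s y) = c *s br x y"
    using br_comb_right[of x 1 y 1 z] br_comb_right[of x c y 0 0] by simp_all
qed

lemma linear_br_left: "Vector_Spaces.linear (*s) (*s) (\<lambda>x. br x z)"
proof unfold_locales
  fix x y and c :: complex
  show "br (x + y) z = br x z + br y z" "br (c *s x) z = c *s br x z"
    using br_comb_left[of 1 x 1 y z] br_comb_left[of c x 0 0 z] by simp_all
qed

sublocale R: Vector_Spaces.linear "(*s)" "(*s)" "br x" for x
  by (rule linear_br)

sublocale L: Vector_Spaces.linear "(*s)" "(*s)" "\<lambda>x. br x z" for z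
  by (rule linear_br_left)

lemmas br_simps = R.add R.diff R.neg R.scale L.add L.diff L.neg L.scale
lemmas br_zero [simp] = R.zero L.zero

lemma br_antisym: "br x y = - br y x"
proof -
  have "br (x + y) (x + y) = br x x + br y x + (br x y + br y y)"
    by (simp only: R.add L.add)
  then have "br x y + br y x = 0"
    by (simp add: add.commute)
  then show ?thesis by (simp add: eq_neg_iff_add_eq_0)
qed

lemma jacobi: "br x (br y z) = br (br x y) z + br y (br x z)"
proof -
  have "br x (br y z) + - br y (br x z) + - br (br x y) z = 0"
    using br_cyclic[of x y z] unfolding br_antisym[of z "br x y"] br_antisym[of z x] R.neg .
  then show ?thesis by (simp add: algebra_simps)
qed

lemma jacobi': "br (br x y) z = br x (br y z) - br y (br x z)"
  unfolding jacobi[of x y z] by simp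

lemma bilinear_br: "bilinear br"
proof -
  have "r *\<^sub>R x = complex_of_real r *s x" for r and x :: "complex^'n"
    by (simp add: vec_eq_iff scaleR_conv_of_real[where 'a=complex])
  then show ?thesis
    unfolding bilinear_def by (auto intro!: linearI simp: br_simps)
qed

lemma linear_br_pow: "Vector_Spaces.linear (*s) (*s) (br e ^^ i)"
proof (induction i)
  case 0
  show ?case using vec.linear_id by (simp add: id_def)
next
  case (Suc i)
  then show ?case
    using Vector_Spaces.linear_compose[OF Suc linear_br] by (simp add: o_def)
qed

sublocale P: Vector_Spaces.linear "(*s)" "(*s)" "br e ^^ i" for e i
  by (rule linear_br_pow)

lemma ad_mat_vector: "ad_mat br x *v y = br x y"
proof -
  have "ad_mat br x = matrix (br x)"
    by (simp add: ad_mat_def matrix_def)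
  then show ?thesis
    by (simp add: matrix_works linear_br)
qed

lemma mat_pow_ad: "mat_pow (ad_mat br x) k *v y = (br x ^^ k) y"
proof -
  have "(*v) (ad_mat br x) = br x"
    by (rule ext) (rule ad_mat_vector)
  then show ?thesis by (simp add: mat_pow_vector)
qed

lemma mat_pow_ad_eq_0: "mat_pow (ad_mat br x) k = 0 \<longleftrightarrow> (\<forall>y. (br x ^^ k) y = 0)"
  by (simp add: matrix_eq mat_pow_ad)

lemma killing_trace: "killing br x y = trace (ad_mat br x ** ad_mat br y)"
proof -
  have "(ad_mat br x ** ad_mat br y) $ i $ i = br x (br y (axis i 1)) $ i" for i
  proof -
    have "(ad_mat br x ** ad_mat br y) $ i $ i = ((ad_mat br x ** ad_mat br y) *v axis i 1) $ i"
      by (simp add: matrix_vector_mult_def axis_def if_distrib cong: if_cong)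
    then show ?thesis
      by (simp add: ad_mat_vector flip: matrix_vector_mul_assoc)
  qed
  then show ?thesis
    by (simp add: killing_def trace_def)
qed

lemma killing_sym: "killing br x y = killing br y x"
  unfolding killing_trace by (rule trace_mul_sym)

lemma killing_add_left: "killing br (x + y) z = killing br x z + killing br y z"
  and killing_add_right: "killing br z (x + y) = killing br z x + killing br z y"
  and killing_diff_left: "killing br (x - y) z = killing br x z - killing br y z"
  and killing_diff_right: "killing br z (x - y) = killing br z x - killing br z y"
  and killing_scale_left: "killing br (c *s x) z = c * killing br x z"
  and killing_scale_right: "killing br z (c *s x) = c * killing br z x"
  and killing_neg_left: "killing br (- x) z = - killing br x z"
  and killing_neg_right: "killing br z (- x) = - killing br z x"
  by (simp_all add: killing_def br_simps sum.distrib sum_subtractf sum_distrib_left sum_negf)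

lemma killing_zero [simp]: "killing br 0 z = 0" "killing br z 0 = 0"
  by (simp_all add: killing_def)

lemmas killing_simps = killing_add_left killing_add_right killing_diff_left killing_diff_right
  killing_scale_left killing_scale_right killing_neg_left killing_neg_right

lemma killing_invariant: "killing br (br x y) z = killing br x (br y z)"
proof -
  let ?a = "ad_mat br"
  have c: "?a (br u v) = ?a u ** ?a v - ?a v ** ?a u" for u v
    by (simp add: matrix_eq ad_mat_vector jacobi' matrix_vector_mult_diff_rdistrib flip: matrix_vector_mul_assoc)
  have d: "(A - B) ** C = A ** C - B ** C" "C ** (A - B) = C ** A - C ** B"
    for A B C :: "complex^'n^'n"
    by (simp_all add: matrix_matrix_mult_def vec_eq_iff algebra_simps sum_subtractf)
  show ?thesis
    unfolding killing_trace c d trace_sub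
    using trace_mul_sym[of "?a y" "?a x ** ?a z"] by (simp add: matrix_mul_assoc)
qed

lemma killing_skew: "killing br (br x y) z = - killing br y (br x z)"
  using killing_invariant[of y x z] br_antisym[of x y] by (simp add: killing_simps)

text \<open>With \<open>E = ad e\<close>, \<open>H = ad h\<close>, \<open>V = ad v\<close>, these relations alone imply
  \<open>E^(i+1) V - V E^(i+1) = (i+1) (H - i) E^i\<close>, which forces \<open>H\<close> to act by \<open>i\<close> modulo \<open>im E^(i+1)\<close>
  on vectors of \<open>im E^i\<close> killed by \<open>E\<close>.\<close>
definition neutral :: "complex^'n \<Rightarrow> complex^'n \<Rightarrow> complex^'n \<Rightarrow> bool" where
  "neutral e h v \<longleftrightarrow> br e v = h \<and> br h e = 2 *s e"

lemma neutral_swap: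
  assumes "neutral e h v"
  shows "br e (br h u) = br h (br e u) - 2 *s br e u"
  using jacobi[of h e u] assms by (simp add: neutral_def br_simps algebra_simps)

lemma neutral_pow:
  assumes "neutral e h v"
  shows "(br e ^^ i) (br h u) = br h ((br e ^^ i) u) - (2 * of_nat i) *s (br e ^^ i) u"
proof (induction i)
  case (Suc i)
  have "(br e ^^ Suc i) (br h u) = br e (br h ((br e ^^ i) u) - (2 * of_nat i) *s (br e ^^ i) u)"
    by (simp add: Suc)
  then show ?case
    by (simp add: R.diff R.scale neutral_swap[OF assms] vec_eq_iff algebra_simps)
qed simp

lemma neutral_commutator:
  assumes "neutral e h v"
  shows "(br e ^^ Suc i) (br v w) - br v ((br e ^^ Suc i) w)
    = of_nat (Suc i) *s (br h ((br e ^^ i) w) - of_nat i *s (br e ^^ i) w)"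
proof (induction i)
  case 0
  show ?case
    using assms by (simp add: jacobi[of e v] neutral_def)
next
  case (Suc i)
  let ?w = "(br e ^^ Suc i) w"
  have "(br e ^^ Suc (Suc i)) (br v w) = br e (br v ?w
      + of_nat (Suc i) *s (br h ((br e ^^ i) w) - of_nat i *s (br e ^^ i) w))"
    by (subst Suc[symmetric]) simp
  also have "\<dots> = br v (br e ?w) + br h ?w
      + of_nat (Suc i) *s (br h ?w - 2 *s ?w - of_nat i *s ?w)"
    using assms
    by (simp add: R.add R.scale R.diff jacobi[of e v] neutral_def neutral_swap[OF assms] del: of_nat_Suc)
  finally show ?case
    by (simp add: vec_eq_iff algebra_simps)
qed

lemma neutral_step:
  assumes "neutral e h v" "br e ((br e ^^ i) w) = 0"
  obtains w' where "br h ((br e ^^ i) w) - of_nat i *s (br e ^^ i) w = (br e ^^ Suc i) w'"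
proof
  have "br h ((br e ^^ i) w) - of_nat i *s (br e ^^ i) w
      = (1 / of_nat (Suc i)) *s (of_nat (Suc i) *s (br h ((br e ^^ i) w) - of_nat i *s (br e ^^ i) w))"
    by (simp del: of_nat_Suc)
  also have "\<dots> = (br e ^^ Suc i) ((1 / of_nat (Suc i)) *s br v w)"
    unfolding neutral_commutator[OF assms(1), symmetric] using assms(2)
    by (simp add: R.scale P.scale)
  finally show "br h ((br e ^^ i) w) - of_nat i *s (br e ^^ i) w
    = (br e ^^ Suc i) ((1 / of_nat (Suc i)) *s br v w)" .
qed

lemma weight_on_kernel:
  assumes e: "neutral e h v" and nil: "\<And>w. (br e ^^ k) w = 0"
    and z: "br e z = 0" "br h z = c *s z" and c: "\<And>i. i < k \<Longrightarrow> c \<noteq> of_nat i"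
  shows "z = 0"
proof -
  have "\<exists>w. z = (br e ^^ i) w" if "i \<le> k" for i
    using that
  proof (induction i)
    case (Suc i)
    then obtain w where w: "z = (br e ^^ i) w" by auto
    with z(1) neutral_step[OF e, of i w] obtain w' where "br h z - of_nat i *s z = (br e ^^ Suc i) w'"
      by auto
    then have "(c - of_nat i) *s z = (br e ^^ Suc i) w'"
      using z(2) by (simp add: vec_eq_iff algebra_simps)
    moreover define b where "b = c - of_nat i"
    ultimately have "b *s z = (br e ^^ Suc i) w'"
      by simp
    moreover have "b \<noteq> 0"
      using c[of i] Suc.prems by (simp add: b_def)
    then have "z = (1 / b) *s (b *s z)"
      by simp
    ultimately have "z = (br e ^^ Suc i) ((1 / b) *s w')"
      by (simp only: P.scale)
    then show ?case by blast
  qed auto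
  then show ?thesis using nil by (metis order_refl)
qed

lemma weight_bound:
  assumes e: "neutral e h v" and nil: "\<And>w. (br e ^^ Suc k) w = 0"
    and u: "br h u = of_nat m *s u" and m: "m > k"
  shows "u = 0"
proof -
  have "(br e ^^ (Suc k - j)) u = 0" if "j \<le> Suc k" for j
    using that
  proof (induction j)
    case 0
    show ?case using nil by simp
  next
    case (Suc j)
    let ?u = "(br e ^^ (Suc k - Suc j)) u"
    have "Suc k - j = Suc (Suc k - Suc j)"
      using Suc.prems by simp
    then have 1: "br e ?u = 0"
      using Suc.IH Suc.prems by simp
    have 2: "br h ((br e ^^ i) u) = of_nat (m + 2 * i) *s (br e ^^ i) u" for i
      using neutral_pow[OF e, of i u]
      by (simp add: u P.scale vec_eq_iff algebra_simps)
    show ?case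
    proof (rule weight_on_kernel[OF e nil 1 2])
      fix i assume "i < Suc k"
      then show "complex_of_nat (m + 2 * (Suc k - Suc j)) \<noteq> of_nat i"
        using m unfolding of_nat_eq_iff by linarith
    qed
  qed
  from this[of "Suc k"] show ?thesis by simp
qed

lemma killing_weight_kernel_image:
  assumes e: "neutral e h v" and nil: "\<And>w. (br e ^^ k) w = 0"
    and y: "br h y = of_nat m *s y" and d: "br e (br e w) = 0"
  shows "killing br (br e w) y = 0"
proof -
  have "br e ((br e ^^ Suc i) w) = 0 \<Longrightarrow> killing br ((br e ^^ Suc i) w) y = 0" if "i \<le> k" for i w
    using that
  proof (induction arbitrary: w rule: inc_induct)
    case base
    then show ?case using nil by simp
  next
    case (step i)
    let ?z = "(br e ^^ Suc i) w"
    obtain w' where w': "br h ?z - of_nat (Suc i) *s ?z = (br e ^^ Suc (Suc i)) w'"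
      using neutral_step[OF e step.prems] .
    have "br e (br h ?z - of_nat (Suc i) *s ?z) = 0"
      using step.prems by (simp add: neutral_swap[OF e] R.diff R.scale del: of_nat_Suc)
    then have "killing br (br h ?z - of_nat (Suc i) *s ?z) y = 0"
      unfolding w' by (rule step.IH)
    then have "- of_nat m * killing br ?z y - of_nat (Suc i) * killing br ?z y = 0"
      using killing_skew[of h ?z y]
      by (simp only: killing_diff_left killing_scale_left killing_scale_right y minus_mult_left)
    moreover have "of_nat (m + Suc i) * killing br ?z y
        = - (- of_nat m * killing br ?z y - of_nat (Suc i) * killing br ?z y)"
      by (simp add: algebra_simps)
    ultimately have "of_nat (m + Suc i) * killing br ?z y = 0"
      by (simp only: minus_zero)
    then show ?case
      by (metis add_Suc_right mult_eq_0_iff nat.distinct(1) of_nat_eq_0_iff)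
  qed
  from this[of 0 w] d show ?thesis by simp
qed

lemma killing_kernel_image:
  assumes "br e z = 0" shows "killing br z (br e w) = 0"
  using killing_skew[of e z w] assms by simp

lemma neutral_top:
  assumes "neutral e h v" "\<And>w. (br e ^^ Suc i) w = 0"
  shows "br h ((br e ^^ i) w) = of_nat i *s (br e ^^ i) w"
proof -
  have "of_nat (Suc i) *s (br h ((br e ^^ i) w) - of_nat i *s (br e ^^ i) w) = 0"
    unfolding neutral_commutator[OF assms(1), symmetric] assms(2) by simp
  then show ?thesis
    by (metis vec.scale_eq_0_iff of_nat_eq_0_iff nat.distinct(1) right_minus_eq)
qed

lemma neutral_kernel:
  assumes "neutral e h v" "br e z = 0" shows "br e (br h z) = 0"
  using neutral_swap[OF assms(1), of z] assms(2) by simp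

text \<open>Morozov's lemma: the correction \<open>g\<close> of \<open>v\<close> is \<open>(H + 2)^(-1) (H v + 2 v)\<close>, where \<open>H + 2\<close> is
  inverted on \<open>ker E\<close> through the identity \<open>H (H - 1) (H - 2) = 0\<close> valid there.\<close>
lemma complete_triple:
  assumes e: "neutral e h v" and cube: "\<And>w. br e (br e (br e w)) = 0"
  obtains f where "sl2_triple br e h f"
proof -
  define z where "z = br h v + 2 *s v"
  have z0: "br e z = 0"
    using e neutral_swap[OF e, of v] by (simp add: z_def R.add R.scale neutral_def)
  obtain w1 where w1: "br h z = br e w1"
    using neutral_step[OF e, of 0 z] z0 by auto
  have 1: "br e (br h z) = 0"
    using neutral_kernel[OF e z0] .
  obtain w2 where w2: "br h (br h z) - br h z = br e (br e w2)"
    using neutral_step[OF e, of 1 w1] 1 w1 by auto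
  have 2: "br e (br h (br h z) - br h z) = 0"
    using neutral_kernel[OF e 1] 1 by (simp add: R.diff)
  obtain w3 where "br h (br e (br e w2)) - 2 *s br e (br e w2) = br e (br e (br e w3))"
    using neutral_step[OF e, of 2 w2] 2 w2 by (auto simp: numeral_2_eq_2)
  then have 3: "br h (br h (br h z)) - 3 *s br h (br h z) + 2 *s br h z = 0"
    using cube by (simp add: w2[symmetric] br_simps vec_eq_iff algebra_simps)
  define g where "g = (1/24) *s (br h (br h z) - 5 *s br h z + 12 *s z)"
  have g0: "br e g = 0"
    using z0 1 neutral_kernel[OF e 1] by (simp add: g_def br_simps)
  have "br h g + 2 *s g = (1/24) *s (br h (br h (br h z)) - 3 *s br h (br h z) + 2 *s br h z) + z"
    by (simp add: g_def br_simps vec_eq_iff algebra_simps)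
  then have "br h g + 2 *s g = br h v + 2 *s v"
    by (simp add: 3) (simp add: z_def)
  then have "br h (v - g) = (-2) *s (v - g)"
    by (simp add: br_simps vec_eq_iff algebra_simps)
  moreover have "br e (v - g) = h"
    using e g0 by (simp add: R.diff neutral_def)
  ultimately have "sl2_triple br e h (v - g)"
    using e unfolding sl2_triple_def neutral_def by blast
  with that show ?thesis .
qed

lemma pow_zero_mono:
  assumes "\<And>w. (br e ^^ k) w = 0" "k \<le> n" shows "(br e ^^ n) w = 0"
proof -
  have "(br e ^^ n) w = (br e ^^ (n - k)) ((br e ^^ k) w)"
    using assms(2) funpow_add[of "n - k" k "br e"] by simp
  with assms(1) show ?thesis by simp
qed

lemma height_eq_2_iff:
  assumes nil: "\<And>w. (br e ^^ k) w = 0"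
  shows "height br e = 2 \<longleftrightarrow> (\<exists>w. br e (br e w) \<noteq> 0) \<and> (\<forall>w. br e (br e (br e w)) = 0)"
proof
  let ?P = "\<lambda>k. mat_pow (ad_mat br e) k \<noteq> 0"
  have P: "?P n \<longleftrightarrow> (\<exists>w. (br e ^^ n) w \<noteq> 0)" for n
    by (simp add: mat_pow_ad_eq_0)
  have bound: "n \<le> k" if "?P n" for n
    using that pow_zero_mono[of k e n, OF nil] by (auto simp: P intro: ccontr)
  {
    assume h: "height br e = 2"
    have "\<not> ?P 3"
      using Greatest_le_nat[of ?P 3 k] bound h by (auto simp: height_def)
    moreover have "?P 2"
    proof -
      have "?P 0"
        unfolding P by (rule exI[of _ "axis undefined 1"]) (simp add: axis_eq_0_iff)
      then have "?P (Greatest ?P)"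
        by (rule GreatestI_nat) (use bound in blast)
      with h show ?thesis
        by (simp add: height_def)
    qed
    ultimately show "(\<exists>w. br e (br e w) \<noteq> 0) \<and> (\<forall>w. br e (br e (br e w)) = 0)"
      unfolding P by (simp add: numeral_2_eq_2 numeral_3_eq_3)
  }
  assume r: "(\<exists>w. br e (br e w) \<noteq> 0) \<and> (\<forall>w. br e (br e (br e w)) = 0)"
  have "n \<le> 2" if "?P n" for n
    using that r pow_zero_mono[of 3 e n] by (fastforce simp: P numeral_3_eq_3)
  moreover have "?P 2"
    using r unfolding P by (simp add: numeral_2_eq_2)
  ultimately show "height br e = 2"
    unfolding height_def by (intro Greatest_equality)
qed

definition automorphism :: "complex^'n^'n \<Rightarrow> bool" where
  "automorphism A \<longleftrightarrow> (\<forall>y z. A *v br y z = br (A *v y) (A *v z)) \<and> surj ((*v) A)"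

lemma automorphism_exp: "automorphism (mat_exp (ad_mat br x))"
  unfolding automorphism_def
proof (intro conjI allI)
  fix y z
  let ?c = "\<lambda>k u. (1 / fact k) *\<^sub>R (mat_pow (ad_mat br x) k *v u)"
  have leibniz: "(br x ^^ n) (br y z) = (\<Sum>i\<le>n. of_nat (n choose i) *\<^sub>R br ((br x ^^ i) y) ((br x ^^ (n - i)) z))" for n
  proof (induction n)
    case (Suc n)
    let ?g = "\<lambda>i j. br ((br x ^^ i) y) ((br x ^^ j) z)"
    have "linear (br x)"
      using bilinear_br by (simp add: bilinear_def)
    then interpret lx: linear "br x" .
    have "(br x ^^ Suc n) (br y z) = (\<Sum>i\<le>n. of_nat (n choose i) *\<^sub>R (?g (Suc i) (n - i) + ?g i (Suc (n - i))))"
      by (simp add: Suc lx.sum lx.scale jacobi[of x])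
    also have "\<dots> = (\<Sum>i\<le>n. of_nat (n choose i) *\<^sub>R ?g (Suc i) (n - i))
        + (\<Sum>i\<le>n. of_nat (n choose i) *\<^sub>R ?g i (Suc n - i))"
      by (simp add: scaleR_right_distrib sum.distrib Suc_diff_le)
    also have "(\<Sum>i\<le>n. of_nat (n choose i) *\<^sub>R ?g i (Suc n - i)) =
        (\<Sum>i\<le>Suc n. of_nat (n choose i) *\<^sub>R ?g i (Suc n - i))"
      by simp
    also have "\<dots> = ?g 0 (Suc n) + (\<Sum>i\<le>n. of_nat (n choose Suc i) *\<^sub>R ?g (Suc i) (n - i))"
      by (subst sum.atMost_Suc_shift) simp
    also have "(\<Sum>i\<le>n. of_nat (n choose i) *\<^sub>R ?g (Suc i) (n - i)) +
        (?g 0 (Suc n) + (\<Sum>i\<le>n. of_nat (n choose Suc i) *\<^sub>R ?g (Suc i) (n - i)))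
      = ?g 0 (Suc n) + (\<Sum>i\<le>n. of_nat (Suc n choose Suc i) *\<^sub>R ?g (Suc i) (n - i))"
      by (simp add: scaleR_left_distrib sum.distrib)
    also have "\<dots> = (\<Sum>i\<le>Suc n. of_nat (Suc n choose i) *\<^sub>R ?g i (Suc n - i))"
      by (subst sum.atMost_Suc_shift) simp
    finally show ?case .
  qed simp
  have "(\<lambda>n. \<Sum>i\<le>n. br (?c i y) (?c (n - i) z)) sums br (\<Sum>k. ?c k y) (\<Sum>k. ?c k z)"
    by (rule bilinear_Cauchy_product_sums[OF bilinear_br mat_exp_vector_summable mat_exp_vector_summable])
  moreover have "(\<Sum>i\<le>n. br (?c i y) (?c (n - i) z)) = ?c n (br y z)" for n
    unfolding mat_pow_ad leibniz scaleR_right.sum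
    by (intro sum.cong)
       (simp_all add: bilinear_lmul[OF bilinear_br] bilinear_rmul[OF bilinear_br] binomial_fact field_simps)
  ultimately have "(\<lambda>n. ?c n (br y z)) sums br (\<Sum>k. ?c k y) (\<Sum>k. ?c k z)"
    by simp
  then show "mat_exp (ad_mat br x) *v br y z = br (mat_exp (ad_mat br x) *v y) (mat_exp (ad_mat br x) *v z)"
    by (simp add: mat_exp_vector sums_iff)
next
  show "surj ((*v) (mat_exp (ad_mat br x)))"
    by (rule surjI[where f = "(*v) (mat_exp (- ad_mat br x))"]) (rule mat_exp_uminus)
qed

lemma automorphism_inner_auts:
  assumes "A \<in> inner_auts br" shows "automorphism A"
  using assms
proof induction
  case id
  then show ?case by (simp add: automorphism_def surj_def)
next
  case (step A x)
  have "(*v) (mat_exp (ad_mat br x) ** A) = (*v) (mat_exp (ad_mat br x)) \<circ> (*v) A"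
    by (simp add: fun_eq_iff matrix_vector_mul_assoc)
  then have "surj ((*v) (mat_exp (ad_mat br x) ** A))"
    using automorphism_exp[of x] step.IH comp_surj by (metis automorphism_def)
  then show ?case
    using automorphism_exp[of x] step.IH
    by (simp add: automorphism_def flip: matrix_vector_mul_assoc)
qed

lemma automorphism_pow:
  assumes "automorphism A"
  shows "(br (A *v e) ^^ k) (A *v w) = A *v (br e ^^ k) w"
  using assms by (induction k) (auto simp: automorphism_def)

lemma automorphism_nilpotent:
  assumes "automorphism A" "\<And>w. (br e ^^ k) w = 0"
  shows "(br (A *v e) ^^ k) w = 0"
proof -
  obtain u where "w = A *v u"
    using assms(1) unfolding automorphism_def surj_def by blast
  then show ?thesis
    using assms by (simp add: automorphism_pow)
qed

lemma mat_exp_square_zero: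
  assumes "br y (br y u) = 0"
  shows "mat_exp (ad_mat br y) *v u = u + br y u"
proof -
  have "(\<lambda>k. (1 / fact k) *\<^sub>R (mat_pow (ad_mat br y) k *v u)) sums
      (\<Sum>k\<in>{0, 1}. (1 / fact k) *\<^sub>R (mat_pow (ad_mat br y) k *v u))"
  proof (rule sums_finite)
    fix k :: nat assume "k \<notin> {0, 1}"
    then have "k = (k - 2) + 2"
      by auto
    then obtain j where "k = j + 2" ..
    then have "(br y ^^ k) u = (br y ^^ j) ((br y ^^ 2) u)"
      by (simp only: funpow_add o_apply)
    then show "(1 / fact k) *\<^sub>R (mat_pow (ad_mat br y) k *v u) = 0"
      using assms by (simp add: mat_pow_ad numeral_2_eq_2)
  qed simp
  then show ?thesis
    by (simp add: mat_exp_vector sums_iff mat_pow_ad ad_mat_vector)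
qed

end

section \<open>Compact real forms\<close>

locale compact_lie = lie br for br :: "complex^'n \<Rightarrow> complex^'n \<Rightarrow> complex^'n" +
  fixes K :: "(complex^'n) set"
  assumes compact: "compact_real_form br K"
begin

lemma compactD:
  shows "real_subspace K" and "\<forall>x\<in>K. \<forall>y\<in>K. br x y \<in> K" and K_cap: "K \<inter> times_i K = {0}"
    and "\<forall>z. \<exists>x\<in>K. \<exists>y\<in>K. z = x + \<i> *s y"
    and "\<forall>x\<in>K. x \<noteq> 0 \<longrightarrow> killing br x x \<in> \<real> \<and> Re (killing br x x) < 0"
  using compact unfolding compact_real_form_def by - (elim conjE, assumption)+

lemma K_add: "x \<in> K \<Longrightarrow> y \<in> K \<Longrightarrow> x + y \<in> K"
  and K_scale: "x \<in> K \<Longrightarrow> complex_of_real r *s x \<in> K"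
  and K_zero: "0 \<in> K"
  using compactD(1) unfolding real_subspace_def by auto

lemma K_br: "x \<in> K \<Longrightarrow> y \<in> K \<Longrightarrow> br x y \<in> K"
  using compactD(2) by blast

lemma K_ex: obtains x y where "x \<in> K" "y \<in> K" "z = x + \<i> *s y"
  using compactD(4) by blast

lemma K_neg: "x \<in> K \<Longrightarrow> x \<noteq> 0 \<Longrightarrow> Re (killing br x x) < 0"
  and K_real: "x \<in> K \<Longrightarrow> killing br x x \<in> \<real>"
  using compactD(5) by (blast, cases "x = 0") auto

lemma K_uminus: "x \<in> K \<Longrightarrow> - x \<in> K"
  using K_scale[of x "-1"] by simp

lemma K_diff: "x \<in> K \<Longrightarrow> y \<in> K \<Longrightarrow> x - y \<in> K"
  using K_add[of x "- y"] K_uminus by simp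

lemma K_decomp_unique:
  assumes "x \<in> K" "y \<in> K" "x' \<in> K" "y' \<in> K" "x + \<i> *s y = x' + \<i> *s y'"
  shows "x = x' \<and> y = y'"
proof -
  have "x - x' = \<i> *s (y' - y)"
    using assms(5) by (simp add: vec_eq_iff algebra_simps)
  moreover have "y' - y \<in> K" "x - x' \<in> K"
    using assms K_diff by auto
  ultimately have "x - x' \<in> K \<inter> times_i K"
    unfolding times_i_def by blast
  then have "x - x' = 0" using K_cap by blast
  moreover from this have "y' - y = 0"
    using \<open>x - x' = \<i> *s (y' - y)\<close> by (simp add: vec_eq_iff)
  ultimately show ?thesis by auto
qed

definition cj :: "complex^'n \<Rightarrow> complex^'n" where
  "cj z = (THE w. \<exists>x\<in>K. \<exists>y\<in>K. z = x + \<i> *s y \<and> w = x - \<i> *s y)"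

lemma cj_eq: "x \<in> K \<Longrightarrow> y \<in> K \<Longrightarrow> cj (x + \<i> *s y) = x - \<i> *s y"
  unfolding cj_def
proof (rule the_equality)
  fix w assume "x \<in> K" "y \<in> K" and "\<exists>x'\<in>K. \<exists>y'\<in>K. x + \<i> *s y = x' + \<i> *s y' \<and> w = x' - \<i> *s y'"
  then obtain x' y' where "x' \<in> K" "y' \<in> K" "x + \<i> *s y = x' + \<i> *s y'" "w = x' - \<i> *s y'"
    by blast
  with K_decomp_unique[OF \<open>x \<in> K\<close> \<open>y \<in> K\<close>, of x' y'] show "w = x - \<i> *s y"
    by simp
qed blast

lemma cj_add: "cj (z + w) = cj z + cj w"
proof -
  obtain x y where z: "x \<in> K" "y \<in> K" "z = x + \<i> *s y"
    by (rule K_ex)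
  obtain x' y' where w: "x' \<in> K" "y' \<in> K" "w = x' + \<i> *s y'"
    by (rule K_ex)
  have "cj ((x + x') + \<i> *s (y + y')) = (x + x') - \<i> *s (y + y')"
    using z w by (intro cj_eq K_add)
  then show ?thesis
    using z w by (simp add: cj_eq algebra_simps)
qed

lemma cj_scale: "cj (c *s z) = cnj c *s cj z"
proof -
  obtain x y where z: "x \<in> K" "y \<in> K" "z = x + \<i> *s y"
    by (rule K_ex)
  let ?a = "complex_of_real (Re c)" and ?b = "complex_of_real (Im c)"
  have "cj ((?a *s x - ?b *s y) + \<i> *s (?a *s y + ?b *s x))
      = (?a *s x - ?b *s y) - \<i> *s (?a *s y + ?b *s x)"
    using z by (intro cj_eq K_add K_diff K_scale)
  moreover have "c *s z = (?a *s x - ?b *s y) + \<i> *s (?a *s y + ?b *s x)"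
    unfolding z by (simp add: vec_eq_iff complex_eq_iff algebra_simps)
  moreover have "cnj c *s cj z = (?a *s x - ?b *s y) - \<i> *s (?a *s y + ?b *s x)"
    unfolding z cj_eq[OF z(1,2)] by (simp add: vec_eq_iff complex_eq_iff algebra_simps)
  ultimately show ?thesis by simp
qed

lemma cj_uminus: "cj (- z) = - cj z"
  using cj_scale[of "-1" z] by simp

lemma cj_diff: "cj (z - w) = cj z - cj w"
  using cj_add[of z "- w"] by (simp add: cj_uminus)

lemma cj_K: "x \<in> K \<Longrightarrow> cj x = x"
  using cj_eq[OF _ K_zero, of x] by simp

lemma cj_cj: "cj (cj z) = z"
proof -
  obtain x y where z: "x \<in> K" "y \<in> K" "z = x + \<i> *s y"
    by (rule K_ex)
  then show ?thesis
    by (simp add: cj_add cj_diff cj_scale cj_K)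
qed

lemma cj_br: "cj (br z w) = br (cj z) (cj w)"
proof -
  obtain x y where z: "x \<in> K" "y \<in> K" "z = x + \<i> *s y"
    by (rule K_ex)
  obtain x' y' where w: "x' \<in> K" "y' \<in> K" "w = x' + \<i> *s y'"
    by (rule K_ex)
  show ?thesis
    unfolding z w using z(1,2) w(1,2) by (simp add: br_simps cj_add cj_diff cj_scale cj_K K_br cj_uminus)
qed

lemma times_i_K: "h \<in> times_i K \<longleftrightarrow> cj h = - h"
proof
  assume "h \<in> times_i K"
  then show "cj h = - h"
    by (auto simp: times_i_def cj_scale cj_K)
next
  assume h: "cj h = - h"
  obtain x y where z: "x \<in> K" "y \<in> K" "h = x + \<i> *s y"
    by (rule K_ex)
  with h have "x + x = 0"
    by (simp add: cj_eq)
  then have "x = 0"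
    by (simp add: vec_eq_iff)
  with z show "h \<in> times_i K"
    by (auto simp: times_i_def)
qed

lemma cj_fixed: "cj x = x \<Longrightarrow> x \<in> K"
proof -
  assume h: "cj x = x"
  obtain a y where z: "a \<in> K" "y \<in> K" "x = a + \<i> *s y"
    by (rule K_ex)
  with h have "\<i> *s y + \<i> *s y = 0"
    by (simp add: cj_eq)
  then have "y = 0"
    by (simp add: vec_eq_iff)
  with z show "x \<in> K" by simp
qed

lemma killing_K_real:
  assumes "x \<in> K" "y \<in> K" shows "killing br x y \<in> \<real>"
proof -
  have "killing br (x + y) (x + y) = killing br x x + killing br y y + 2 * killing br x y"
    by (simp add: killing_simps killing_sym[of y x])
  then have "killing br x y = (killing br (x + y) (x + y) - killing br x x - killing br y y) / 2"
    by simp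
  also have "\<dots> \<in> \<real>"
    using assms by (intro Reals_divide Reals_diff K_real K_add) auto
  finally show ?thesis .
qed

lemma killing_cj: "killing br (cj z) (cj w) = cnj (killing br z w)"
proof -
  obtain x y where z: "x \<in> K" "y \<in> K" "z = x + \<i> *s y"
    by (rule K_ex)
  obtain x' y' where w: "x' \<in> K" "y' \<in> K" "w = x' + \<i> *s y'"
    by (rule K_ex)
  show ?thesis
    unfolding z w using z(1,2) w(1,2) killing_K_real[of x x'] killing_K_real[of x y'] killing_K_real[of y x'] killing_K_real[of y y']
    by (simp add: cj_add cj_scale cj_K killing_simps Reals_cnj_iff algebra_simps)
qed

lemma killing_cj_definite:
  assumes "killing br z (cj z) = 0" shows "z = 0"
proof -
  obtain x y where z: "x \<in> K" "y \<in> K" "z = x + \<i> *s y"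
    by (rule K_ex)
  then have "killing br z (cj z) = killing br x x + killing br y y"
    by (simp add: cj_eq killing_simps killing_sym[of y x] algebra_simps)
  then have "Re (killing br x x) + Re (killing br y y) = 0"
    using assms by (metis plus_complex.simps(1) zero_complex.simps(1))
  then have "x = 0 \<and> y = 0"
    using K_neg[OF z(1)] K_neg[OF z(2)] by (cases "x = 0"; cases "y = 0") auto
  then show ?thesis using z by simp
qed

lemma orthogonal_projection:
  assumes W: "vec.subspace W"
  obtains p where "p \<in> W" "\<And>z. z \<in> W \<Longrightarrow> killing br (x - p) (cj z) = 0"
proof -
  have "\<exists>p\<in>vec.span S. \<forall>z\<in>vec.span S. killing br (x - p) (cj z) = 0" if "finite S" for S x
    using that
  proof (induction S arbitrary: x)
    case empty
    then show ?case by (simp add: cj_K K_zero)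
  next
    case (insert a S)
    obtain q where q: "q \<in> vec.span S" "\<And>z. z \<in> vec.span S \<Longrightarrow> killing br (a - q) (cj z) = 0"
      using insert.IH by blast
    obtain p where p: "p \<in> vec.span S" "\<And>z. z \<in> vec.span S \<Longrightarrow> killing br (x - p) (cj z) = 0"
      using insert.IH by blast
    define b where "b = a - q"
    define c where "c = killing br (x - p) (cj b) / killing br b (cj b)"
    have sub: "vec.span S \<subseteq> vec.span (insert a S)"
      by (rule vec.span_mono) blast
    have bS: "b \<in> vec.span (insert a S)"
      unfolding b_def using q(1) sub by (intro vec.span_diff vec.span_base[of a]) auto
    show ?case
    proof (intro bexI[of _ "p + c *s b"] ballI)
      show "p + c *s b \<in> vec.span (insert a S)"
        using p(1) bS sub by (intro vec.span_add vec.span_scale) auto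
      fix z assume "z \<in> vec.span (insert a S)"
      then obtain k where "z - k *s a \<in> vec.span S"
        by (auto simp: vec.span_insert)
      then have s: "z - k *s b \<in> vec.span S"
        using vec.span_add[OF _ vec.span_scale[OF q(1), of k]] by (fastforce simp: b_def algebra_simps)
      have b0: "killing br (x - (p + c *s b)) (cj b) = 0"
        using killing_cj_definite[of b] by (cases "b = 0") (auto simp: c_def killing_simps cj_K K_zero)
      have "killing br (x - (p + c *s b)) (cj (z - k *s b)) = 0"
        using p(2)[OF s] q(2)[OF s] by (simp add: killing_simps b_def)
      with b0 show "killing br (x - (p + c *s b)) (cj z) = 0"
        by (simp add: cj_diff cj_scale killing_diff_right killing_scale_right)
    qed
  qed
  moreover obtain S where "finite S" "vec.span S = W"
    using vec.basis_exists[of W] vec.finiteI_independent W vec.span_subspace by metis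
  ultimately show ?thesis using that by metis
qed

lemma separate:
  assumes W: "vec.subspace W" and x: "x \<notin> W"
  obtains y where "\<And>z. z \<in> W \<Longrightarrow> killing br z y = 0" "killing br x y \<noteq> 0"
proof -
  obtain p where p: "p \<in> W" "\<And>z. z \<in> W \<Longrightarrow> killing br (x - p) (cj z) = 0"
    using orthogonal_projection[OF W] by blast
  have 1: "killing br z (cj (x - p)) = 0" if "z \<in> W" for z
    using p(2)[OF that] killing_cj[of "x - p" "cj z"] by (simp add: cj_cj killing_sym)
  moreover have "killing br x (cj (x - p)) \<noteq> 0"
  proof
    assume "killing br x (cj (x - p)) = 0"
    then have "x - p = 0"
      using 1[OF p(1)] by (intro killing_cj_definite) (simp add: killing_simps)
    with x p(1) show False by simp
  qed
  ultimately show ?thesis using that by blast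
qed

lemma killing_pow_skew: "killing br ((br e ^^ i) w) y = (-1)^i * killing br w ((br e ^^ i) y)"
proof (induction i arbitrary: y)
  case (Suc i)
  have "killing br ((br e ^^ Suc i) w) y = - killing br ((br e ^^ i) w) (br e y)"
    by (simp add: killing_skew[of e])
  then show ?case
    by (simp add: Suc funpow_swap1[of "br e" i y])
qed simp

lemma image_pow_orthogonal:
  assumes "\<And>z. (br e ^^ i) z = 0 \<Longrightarrow> killing br x z = 0"
  shows "x \<in> range (br e ^^ i)"
proof (rule ccontr)
  assume "x \<notin> range (br e ^^ i)"
  moreover have "vec.subspace (range (br e ^^ i))"
    by (rule vec.linear_subspace_image[OF linear_br_pow vec.subspace_UNIV])
  ultimately obtain y where y: "\<And>z. z \<in> range (br e ^^ i) \<Longrightarrow> killing br z y = 0" "killing br x y \<noteq> 0"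
    using separate[of "range (br e ^^ i)" x] by blast
  let ?u = "(br e ^^ i) y"
  have "killing br (cj ?u) ?u = 0"
    using y(1)[of "(br e ^^ i) (cj ?u)"] by (simp add: killing_pow_skew)
  then have "?u = 0"
    by (intro killing_cj_definite) (simp add: killing_sym)
  then show False
    using assms y(2) by blast
qed

lemma kernel_subspace: "vec.subspace {z. br e z = 0}"
  by (simp add: vec.subspace_def br_simps)

lemma image_subspace: "vec.subspace (range (br e))"
  by (rule vec.linear_subspace_image[OF linear_br vec.subspace_UNIV])

lemma kernel_plus_image_orthogonal:
  assumes x: "\<And>z. br e (br e z) = 0 \<Longrightarrow> killing br x (br e z) = 0"
  obtains a b where "br e a = 0" "x = a + br e b"
proof -
  let ?W = "{a + b |a b. a \<in> {z. br e z = 0} \<and> b \<in> range (br e)}"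
  have "x \<in> ?W"
  proof (rule ccontr)
    assume "x \<notin> ?W"
    then obtain y where y: "\<And>z. z \<in> ?W \<Longrightarrow> killing br z y = 0" "killing br x y \<noteq> 0"
      using separate[OF vec.subspace_sums[OF kernel_subspace image_subspace]] by blast
    have W: "killing br (a + br e b) y = 0" if "br e a = 0" for a b
      using that by (intro y(1)) blast
    have "killing br z y = 0" if "br e z = 0" for z
      using W[OF that, of 0] by simp
    then have "y \<in> range (br e)"
      using image_pow_orthogonal[where e = e and i = 1 and x = y] by (simp add: killing_sym)
    then obtain w where w: "y = br e w" by auto
    have "killing br (br e (cj (br e y))) y = 0"
      using W[of 0 "cj (br e y)"] by simp
    then have "br e y = 0"
      by (intro killing_cj_definite) (simp add: killing_skew killing_sym)
    with x[of w] y(2) w show False by simp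
  qed
  with that show ?thesis by auto
qed

lemma exists_neutral:
  assumes cube: "\<And>w. br e (br e (br e w)) = 0"
  obtains v where "neutral e (br e v) v"
proof -
  have "killing br e z = 0" if z: "br e (br e z) = 0" for z
  proof -
    have "br e (br e (br z w)) + br z (br e (br e w)) = 2 *s br e (br z (br e w))" for w
    proof -
      have "br (br e (br e z)) w = br e (br e (br z w)) - 2 *s br e (br z (br e w)) + br z (br e (br e w))"
        by (simp add: jacobi' br_simps vec_eq_iff algebra_simps)
      then show ?thesis
        using z by (simp add: algebra_simps)
    qed
    from nilpotent_product[OF linear_br linear_br cube this]
    have "((*v) (ad_mat br e ** ad_mat br z) ^^ 5) u = 0" for u
      by (simp add: numeral_eq_Suc ad_mat_vector flip: matrix_vector_mul_assoc)
    then show ?thesis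
      unfolding killing_trace by (rule trace_nilpotent)
  qed
  then have "e \<in> range (br e ^^ 2)"
    by (intro image_pow_orthogonal) (simp add: numeral_2_eq_2)
  then obtain y where y: "e = br e (br e y)"
    by (auto simp: numeral_2_eq_2)
  have "br (br e (- 2 *s y)) e = 2 *s e"
    using br_antisym[of "br e y" e] y[symmetric] by (simp add: br_simps)
  then show ?thesis
    by (intro that[of "- 2 *s y"]) (simp add: neutral_def)
qed

text \<open>If \<open>h\<close> commutes with its conjugate, \<open>ad h\<close> is normal for the Hermitian form
  \<open>(x, y) \<mapsto> - killing x (cj y)\<close>, whose adjoint of \<open>ad h\<close> is \<open>- ad (cj h)\<close>.\<close>
lemma normal_real_eigenvector:
  assumes comm: "br h (cj h) = 0" and u: "br h u = complex_of_real c *s u"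
  shows "br (h + cj h) u = 0"
proof -
  let ?c = "complex_of_real c" and ?s = "cj h"
  have c1: "br ?s (br h w) = br h (br ?s w)" for w
    using jacobi[of h ?s w] comm by simp
  have s: "br ?s (cj u) = ?c *s cj u"
    using cj_br[of h u] by (simp add: u cj_scale)
  define y where "y = br ?s u + ?c *s u"
  have "cj y = br h (cj u) + ?c *s cj u"
    by (simp add: y_def cj_add cj_br cj_scale cj_cj)
  moreover have "killing br y Y = - killing br u (br ?s Y - ?c *s Y)" for Y
    by (simp add: y_def killing_simps killing_skew[of ?s])
  ultimately have "killing br y (cj y) = - killing br u (br ?s (br h (cj u) + ?c *s cj u) - ?c *s (br h (cj u) + ?c *s cj u))"
    by simp
  also have "br ?s (br h (cj u) + ?c *s cj u) - ?c *s (br h (cj u) + ?c *s cj u) = 0"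
    by (simp add: R.add R.scale c1 s)
  finally have "y = 0"
    by (intro killing_cj_definite) simp
  then show ?thesis
    using u by (simp add: y_def L.add add.commute)
qed

lemma normal_step:
  assumes comm: "br h (cj h) = 0" and v: "br (h + cj h) (br h v - complex_of_real c *s v) = 0"
  shows "br (h + cj h) v = 0"
proof -
  let ?x = "h + cj h"
  have "br h ?x = 0"
    using comm by (simp add: R.add)
  then have "br h (br ?x v) = br ?x (br h v)"
    using jacobi[of h ?x v] by simp
  also have "\<dots> = complex_of_real c *s br ?x v"
    using v by (simp only: R.diff R.scale right_minus_eq)
  finally have "br ?x (br ?x v) = 0"
    by (rule normal_real_eigenvector[OF comm])
  then have "killing br (br ?x v) (br ?x (cj v)) = 0"
    using killing_skew[of ?x "br ?x v" "cj v"] by simp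
  moreover have "cj (br ?x v) = br ?x (cj v)"
    by (simp add: cj_br cj_add cj_cj add.commute)
  ultimately show ?thesis
    by (intro killing_cj_definite) simp
qed

text \<open>The flag \<open>0 \<le> im E\<^sup>2 \<le> ker E \<inter> im E \<le> ker E + im E \<le> ker E\<^sup>2 \<le> \<gg>\<close> is the weight
  filtration of every neutral element; \<open>H\<close> acts on its successive quotients by \<open>2, 1, 0, -1, -2\<close>.\<close>
lemma normal_neutral_selfadjoint:
  assumes e: "neutral e h v" and cube: "\<And>w. br e (br e (br e w)) = 0" and comm: "br h (cj h) = 0"
  shows "cj h = - h"
proof -
  let ?x = "h + cj h"
  note step = normal_step[OF comm]
  have h2: "br h (br e (br e w)) = 2 *s br e (br e w)" for w
    using neutral_top[OF e, of 2 w] cube by (simp add: numeral_2_eq_2)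
  have F2: "br ?x (br e (br e w)) = 0" for w
    by (rule step[of _ 2]) (simp add: h2)
  have F1: "br ?x (br e w) = 0" if w: "br e (br e w) = 0" for w
  proof (rule step[of _ 1])
    obtain w' where "br h (br e w) - br e w = br e (br e w')"
      using neutral_step[OF e, of 1 w] w by auto
    then show "br ?x (br h (br e w) - complex_of_real 1 *s br e w) = 0"
      using F2[of w'] by simp
  qed
  have F0a: "br ?x a = 0" if a: "br e a = 0" for a
  proof (rule step[of _ 0])
    obtain w' where "br h a = br e w'"
      using neutral_step[OF e, of 0 a] a by auto
    moreover from this have "br e (br e w') = 0"
      using neutral_kernel[OF e a] by simp
    ultimately show "br ?x (br h a - complex_of_real 0 *s a) = 0"
      using F1[of w'] by simp
  qed
  have F0b: "br ?x (br e b) = 0" for b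
  proof (rule step[of _ 0])
    have "br h (br e b) = br e (br h b + 2 *s b)"
      by (simp add: R.add R.scale neutral_swap[OF e])
    moreover have "br e (br e (br h b + 2 *s b)) = 0"
      by (simp add: R.add R.scale R.diff neutral_swap[OF e] h2)
    ultimately show "br ?x (br h (br e b) - complex_of_real 0 *s br e b) = 0"
      using F1 by simp
  qed
  have Fm1: "br ?x u = 0" if u: "br e (br e u) = 0" for u
  proof (rule step[of _ "-1"])
    let ?k = "br h u + u - (1/2) *s br e (br v u)"
    have "br e (br e (br v u)) = 2 *s (br h (br e u) - br e u)"
      using neutral_commutator[OF e, of 1 u] u by simp
    then have "br e ?k = 0"
      by (simp add: R.add R.diff R.scale neutral_swap[OF e] vec_eq_iff)
    then have "br ?x (?k + (1/2) *s br e (br v u)) = 0"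
      by (simp only: R.add R.scale F0a F0b vec.scale_zero_right add_0_left)
    then show "br ?x (br h u - complex_of_real (- 1) *s u) = 0"
      by simp
  qed
  have Fm2: "br ?x u = 0" for u
  proof (rule step[of _ "-2"])
    have "br e (br e (br h u + 2 *s u)) = 0"
      by (simp add: R.add R.scale R.diff neutral_swap[OF e] h2)
    then show "br ?x (br h u - complex_of_real (- 2) *s u) = 0"
      using Fm1 by simp
  qed
  have "killing br ?x ?x = 0"
    by (simp add: killing_def Fm2)
  moreover have "?x \<in> K"
    by (rule cj_fixed) (simp add: cj_add cj_cj add.commute)
  ultimately have "?x = 0"
    using K_neg[of ?x] by force
  then show ?thesis
    by (simp add: add_eq_0_iff)
qed

lemma selfadjoint_isotropic:
  assumes "cj q = - q" "killing br q q = 0" shows "q = 0"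
  using assms by (intro killing_cj_definite) (simp add: killing_simps)

lemma exists_selfadjoint_triple:
  assumes cube: "\<And>w. br e (br e (br e w)) = 0"
  obtains h f where "sl2_triple br e h f" "cj h = - h"
proof -
  obtain v where v: "neutral e (br e v) v"
    using exists_neutral[OF cube] .
  let ?N = "{z. br e z = 0} \<inter> range (br e)"
  have "vec.subspace ?N"
    by (intro vec.subspace_inter kernel_subspace image_subspace)
  then obtain p where p: "p \<in> ?N" "\<And>z. z \<in> ?N \<Longrightarrow> killing br (br e v - p) (cj z) = 0"
    by (rule orthogonal_projection[of _ "br e v"]) blast
  from p(1) obtain q where q: "p = br e q" "br e p = 0" by auto
  define h where "h = br e v - p"
  have e: "neutral e h (v - q)"
    using v q br_antisym[of p e] by (simp add: neutral_def h_def br_simps)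
  have "killing br (cj h) (br e z) = 0" if "br e (br e z) = 0" for z
    using p(2)[of "br e z"] that killing_cj[of h "cj (br e z)"] by (simp add: cj_cj h_def)
  then obtain a b where ab: "br e a = 0" "cj h = a + br e b"
    by (rule kernel_plus_image_orthogonal)
  define w where "w = br h (cj h)"
  have "\<exists>w'. w = br e w'"
  proof -
    obtain w' where "br h a = br e w'"
      using neutral_step[OF e, of 0 a] ab(1) by auto
    then have "w = br e (w' + br h b + 2 *s b)"
      unfolding w_def ab(2) by (simp add: R.add R.scale neutral_swap[OF e])
    then show ?thesis ..
  qed
  moreover have "br e w = 0"
  proof -
    have "br h (br e (br e b)) = 2 *s br e (br e b)"
      using neutral_top[OF e, of 2 b] cube by (simp add: numeral_2_eq_2)
    then show ?thesis
      unfolding w_def ab(2) using neutral_kernel[OF e ab(1)]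
      by (simp add: R.add neutral_swap[OF e])
  qed
  ultimately have "killing br w w = 0"
    using killing_kernel_image by metis
  moreover have "cj w = - w"
    using br_antisym[of "cj h" h] by (simp add: w_def cj_br cj_cj)
  ultimately have "w = 0"
    by (intro selfadjoint_isotropic)
  then have "cj h = - h"
    using normal_neutral_selfadjoint[OF e cube] by (simp add: w_def)
  moreover obtain f where "sl2_triple br e h f"
    using complete_triple[OF e cube] .
  ultimately show ?thesis using that by blast
qed

lemma neutral_of_triple: "sl2_triple br e h f \<Longrightarrow> neutral e h f"
  by (simp add: sl2_triple_def neutral_def)

lemma selfadjoint_neutral_unique:
  assumes 1: "neutral e h v" "cj h = - h" and 2: "neutral e h' v'" "cj h' = - h'"
  shows "h = h'"
proof -
  let ?d = "h - h'"
  have "?d = br e (v - v')"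
    using assms by (simp add: neutral_def R.diff)
  moreover have "br e ?d = 0"
    using assms br_antisym[of e ?d] by (simp add: neutral_def L.diff)
  ultimately have "killing br ?d ?d = 0"
    using killing_kernel_image by metis
  then have "?d = 0"
    using assms by (intro selfadjoint_isotropic) (simp_all add: cj_diff)
  then show ?thesis by simp
qed

lemma selfadjoint_triple_unique:
  assumes nil: "\<And>w. (br e ^^ k) w = 0"
    and 1: "sl2_triple br e h f" "cj h = - h" and 2: "sl2_triple br e h' f'" "cj h' = - h'"
  shows "h = h' \<and> f = f'"
proof -
  have h: "h = h'"
    using selfadjoint_neutral_unique[OF neutral_of_triple[OF 1(1)] 1(2) neutral_of_triple[OF 2(1)] 2(2)] .
  have "f - f' = 0"
  proof (rule weight_on_kernel[OF neutral_of_triple[OF 1(1)] nil])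
    show "br e (f - f') = 0" "br h (f - f') = (-2) *s (f - f')"
      using 1(1)[unfolded h] 2(1) by (simp_all add: h sl2_triple_def R.diff vec_eq_iff)
    show "-2 \<noteq> complex_of_nat i" for i
    proof
      assume "-2 = complex_of_nat i"
      then have "Re (-2) = Re (complex_of_nat i)" by simp
      then show False by simp
    qed
  qed
  with h show ?thesis by simp
qed

lemma selfadjoint_triples_cube_zero:
  assumes e: "sl2_triple br e h f" "cj h = - h" and nil: "\<And>w. (br e ^^ k) w = 0"
    and all: "\<And>y. \<exists>h' f'. sl2_triple br (mat_exp (ad_mat br y) *v e) h' f' \<and> cj h' = - h'"
  shows "br e (br e (br e w)) = 0"
proof (rule ccontr)
  assume "br e (br e (br e w)) \<noteq> 0"
  then have w3: "(br e ^^ 3) w \<noteq> 0" by (simp add: numeral_3_eq_3)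
  define n where "n = (LEAST k. \<forall>w. (br e ^^ k) w = 0)"
  have n: "(br e ^^ n) u = 0" for u
    using LeastI[of "\<lambda>k. \<forall>w. (br e ^^ k) w = 0" k] nil by (simp add: n_def)
  have "n > 3"
  proof (rule ccontr)
    assume "\<not> n > 3"
    then have "(br e ^^ 3) w = (br e ^^ (3 - n)) ((br e ^^ n) w)"
      by (simp only: funpow_add[symmetric, THEN fun_cong, unfolded o_apply]) simp
    with w3 n show False by simp
  qed
  then obtain m where m: "n = Suc m" "m \<ge> 3"
    by (cases n) auto
  obtain w0 where w0: "(br e ^^ m) w0 \<noteq> 0"
    using not_less_Least[of m "\<lambda>k. \<forall>w. (br e ^^ k) w = 0"] m(1) by (auto simp: n_def)
  note ne = neutral_of_triple[OF e(1)]
  note nilm = n[unfolded m(1)]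
  define x where "x = (br e ^^ m) w0"
  have x0: "x \<noteq> 0" using w0 by (simp add: x_def)
  have ex: "br e x = 0" using nilm[of w0] by (simp add: x_def)
  have hx: "br h x = of_nat m *s x"
    unfolding x_def by (rule neutral_top[OF ne nilm])
  define y where "y = br f x"
  define c where "c = complex_of_nat (m - 2)"
  have c: "c = of_nat m - 2"
    using m(2) by (simp add: c_def of_nat_diff)
  have hy: "br h y = c *s y"
  proof -
    have "br h f = (-2) *s f"
      using e(1) by (simp add: sl2_triple_def)
    then have "br h y = (-2) *s y + of_nat m *s y"
      unfolding y_def by (simp only: jacobi[of h f x] L.scale R.scale hx)
    then show ?thesis
      by (simp add: c vec_eq_iff algebra_simps)
  qed
  have ey: "br e y = of_nat m *s x"
    using jacobi[of e f x] e(1) by (simp add: y_def ex hx sl2_triple_def)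
  have yx: "br y x = 0"
  proof (rule weight_bound[OF ne nilm])
    show "br h (br y x) = of_nat (2 * m - 2) *s br y x"
      using m(2) jacobi[of h y x] by (simp add: hy hx br_simps c of_nat_diff vec_eq_iff algebra_simps)
    show "m < 2 * m - 2" using m(2) by simp
  qed
  have ye: "br y e = - (of_nat m *s x)"
    using br_antisym[of y e] ey by simp
  have yh: "br y h = - (c *s y)"
    using br_antisym[of y h] hy by simp
  let ?A = "mat_exp (ad_mat br y)"
  have auto: "automorphism ?A" by (rule automorphism_exp)
  have Ae: "?A *v e = e - of_nat m *s x"
    by (subst mat_exp_square_zero) (simp_all add: ye br_simps yx)
  have Ah: "?A *v h = h - c *s y"
    by (subst mat_exp_square_zero) (simp_all add: yh br_simps)
  have "?A *v (2 *s e) = 2 *s (?A *v e)"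
    by (rule vector_scalar_commute)
  with auto ne have ne1: "neutral (?A *v e) (?A *v h) (?A *v f)"
    unfolding automorphism_def neutral_def by metis
  obtain h' f' where e': "sl2_triple br (?A *v e) h' f'" "cj h' = - h'"
    using all by blast
  define d where "d = h' - ?A *v h"
  have d: "d = br (?A *v e) (f' - ?A *v f)"
    using ne1 e' by (simp add: d_def sl2_triple_def neutral_def R.diff)
  have ed: "br (?A *v e) d = 0"
    using ne1 e' br_antisym[of "?A *v e" d] by (simp add: d_def sl2_triple_def neutral_def L.diff)
  have "br (?A *v h) y = of_nat (m - 2) *s y"
    by (simp add: Ah L.diff L.scale hy c_def)
  from killing_weight_kernel_image[OF ne1 automorphism_nilpotent[OF auto nil] this ed[unfolded d]]
  have dy: "killing br d y = 0"
    by (simp add: d)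
  have dd: "killing br d d = 0"
    using killing_kernel_image[OF ed] d by metis
  have c0: "c \<noteq> 0"
    using m(2) unfolding c_def of_nat_eq_0_iff by simp
  have yy: "killing br y y = 0"
    using killing_skew[of h y y] c0 by (simp add: hy killing_simps)
  have "h' - h = d - c *s y"
    by (simp add: d_def Ah)
  then have "killing br (h' - h) (h' - h) = 0"
    using dy dd yy killing_sym[of y d] by (simp add: killing_simps)
  then have "h' - h = 0"
    using e(2) e'(2) by (intro selfadjoint_isotropic) (simp_all add: cj_diff)
  then have "br h (e - of_nat m *s x) = 2 *s (e - of_nat m *s x)"
    using e'(1) by (simp add: Ae sl2_triple_def)
  then have "(of_nat m * c) *s x = 0"
    using e(1) by (simp add: br_simps hx sl2_triple_def c vec_eq_iff algebra_simps)
  then show False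
    using x0 c0 m(2) by (simp add: vec.scale_eq_0_iff)
qed

end

theorem theorem4p23:
  fixes br :: "complex^'n \<Rightarrow> complex^'n \<Rightarrow> complex^'n"
    and K :: "(complex^'n) set" and e0 :: "complex^'n"
  assumes "simple_lie_algebra br"
    and "compact_real_form br K"
    and "nilpotent_elem br e0" and "e0 \<noteq> 0"
  shows "(moore_penrose_orbit br K (adjoint_orbit br e0) \<longleftrightarrow> height br e0 = 2)
    \<and> (moore_penrose_orbit br K (adjoint_orbit br e0) \<longrightarrow>
         (\<forall>e\<in>adjoint_orbit br e0. \<exists>!hf. sl2_triple br e (fst hf) (snd hf) \<and> fst hf \<in> times_i K))"
proof -
  interpret compact_lie br K
    using assms(1,2) by unfold_locales (simp_all add: simple_lie_algebra_def)
  obtain k where nil0: "\<And>w. (br e0 ^^ k) w = 0"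
    using assms(3) by (auto simp: nilpotent_elem_def mat_pow_ad_eq_0)
  have nil: "(br e ^^ n) w = 0" if "e \<in> adjoint_orbit br e0" "\<And>w. (br e0 ^^ n) w = 0" for e n w
    using that automorphism_nilpotent[OF automorphism_inner_auts]
    by (auto simp: adjoint_orbit_def)
  have id_orbit: "e0 \<in> adjoint_orbit br e0"
    unfolding adjoint_orbit_def by (auto intro!: exI[of _ "mat 1"] inner_auts.id)
  have exp_orbit: "mat_exp (ad_mat br y) *v e0 \<in> adjoint_orbit br e0" for y
    unfolding adjoint_orbit_def
    using inner_auts.step[OF inner_auts.id[of br], of y] matrix_mul_rid[of "mat_exp (ad_mat br y)"]
    by auto
  have "height br e0 = 2" if mp: "moore_penrose_orbit br K (adjoint_orbit br e0)"
  proof -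
    obtain h f where hf: "sl2_triple br e0 h f" "cj h = - h"
      using mp id_orbit by (auto simp: moore_penrose_orbit_def times_i_K)
    have cube: "br e0 (br e0 (br e0 w)) = 0" for w
      using mp exp_orbit
      by (intro selfadjoint_triples_cube_zero[OF hf nil0]) (auto simp: moore_penrose_orbit_def times_i_K)
    have "br e0 (br e0 f) = - (2 *s e0)"
      using hf(1) br_antisym[of e0 h] by (simp add: sl2_triple_def)
    then have "br e0 (br e0 f) \<noteq> 0"
      using assms(4) by (simp add: vec.scale_eq_0_iff)
    with cube show ?thesis
      using height_eq_2_iff[OF nil0] by blast
  qed
  moreover have "moore_penrose_orbit br K (adjoint_orbit br e0)" if h: "height br e0 = 2"
    unfolding moore_penrose_orbit_def times_i_K
  proof
    fix e assume e: "e \<in> adjoint_orbit br e0"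
    have "(br e0 ^^ 3) w = 0" for w
      using h height_eq_2_iff[OF nil0] by (simp add: numeral_3_eq_3)
    from nil[OF e this] have "br e (br e (br e w)) = 0" for w
      by (simp add: numeral_3_eq_3)
    then show "\<exists>h f. sl2_triple br e h f \<and> cj h = - h"
      by (metis exists_selfadjoint_triple)
  qed
  moreover have "\<exists>!hf. sl2_triple br e (fst hf) (snd hf) \<and> fst hf \<in> times_i K"
    if mp: "moore_penrose_orbit br K (adjoint_orbit br e0)" and e: "e \<in> adjoint_orbit br e0" for e
  proof -
    obtain h f where "sl2_triple br e h f" "h \<in> times_i K"
      using mp e by (auto simp: moore_penrose_orbit_def)
    then show ?thesis
      using selfadjoint_triple_unique[OF nil[OF e nil0]]
      by (intro ex1I[of _ "(h, f)"]) (auto simp: times_i_K prod_eq_iff)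
  qed
  ultimately show ?thesis by blast
qed

end
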